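(* Let $G(q)=\sum_{i\ge 0}G_iq^i$ be the formal power series defined in the context, and write $\Delta^{(\ell)}_n=\Delta^{(\ell)}_n(G)$. (1) For each $\ell\in\{0,1,2,3\}$ the sequence $(\Delta^{(\ell)}_n)_{n\ge 0}$ consists only of the values $-1,0,1$ and is $4$-antiperiodic: $\Delta^{(\ell)}_{n+4}=-\Delta^{(\ell)}_n$ for all $n\ge 0$ (hence it is $8$-periodic). Its first eight terms ($n=0,\dots,7$) are: $\Delta^{(0)}_n:\ 1,1,1,0,-1,-1,-1,0$; $\Delta^{(1)}_n:\ 1,0,-1,1,-1,0,1,-1$; $\Delta^{(2)}_n:\ 1,1,1,0,-1,-1,-1,0$; $\Delta^{(3)}_n:\ 1,-1,0,0,-1,1,0,0$. (2) $\Delta^{(0)}_n=\Delta^{(2)}_n$ for all $n\ge 0$, and $\Delta^{(0)}_n=(-1)^n\Delta^{(1)}_{n-2}$ for all $n\ge 2$.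
   Context: $G(q)\in\mathbb{Z}[[q]]$ is the Taylor expansion at $q=0$ of $\frac{q^2+q-1+\sqrt{(1-q+q^2)(1+3q+q^2)}}{2q}$ (square-root branch equal to $1$ at $q=0$); equivalently, $G$ is the unique formal power series satisfying $q\,G(q)^2+(1-q-q^2)G(q)=1$. It begins $G(q)=1+q^2-q^3+2q^4-4q^5+8q^6-17q^7+\cdots$ (it is the $q$-deformation of the golden ratio). For a power series $f=\sum_{i\ge0}f_iq^i$ and integers $\ell,n\ge 0$, the Hankel determinant $\Delta^{(\ell)}_n(f)$ is the determinant of the $n\times n$ matrix $(f_{\ell+i+j})_{0\le i,j\le n-1}$, with $\Delta^{(\ell)}_0(f)=1$. *)

theory Defs
  imports
    "Jordan_Normal_Form.Determinant"
    "HOL-Computational_Algebra.Formal_Power_Series"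
begin

definition is_golden_series :: "int fps \<Rightarrow> bool" where
  "is_golden_series G \<longleftrightarrow> fps_X * G ^ 2 + (1 - fps_X - fps_X ^ 2) * G = 1"

definition golden_series :: "int fps" where
  "golden_series = (THE G. is_golden_series G)"

definition hankel_det :: "nat \<Rightarrow> nat \<Rightarrow> 'a :: comm_ring_1 fps \<Rightarrow> 'a" where
  "hankel_det l n f = det (mat n n (\<lambda>(i, j). fps_nth f (l + i + j)))"

lemma hankel_det_0: "hankel_det l 0 f = 1"
  by (simp add: hankel_det_def)

lemma is_golden_series_unique:
  assumes "is_golden_series G" "is_golden_series H"
  shows "G = H"
proof -
  let ?F = "fps_X * (G + H) + (1 - fps_X - fps_X ^ 2) :: int fps"
  have "(G - H) * ?F = (fps_X * G ^ 2 + (1 - fps_X - fps_X ^ 2) * G)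
      - (fps_X * H ^ 2 + (1 - fps_X - fps_X ^ 2) * H)"
    by (simp add: algebra_simps power2_eq_square)
  also have "\<dots> = 0"
    using assms by (simp add: is_golden_series_def)
  finally have "(G - H) * ?F = 0" .
  moreover have "fps_nth ?F 0 = 1"
    by (simp add: power2_eq_square)
  hence "?F \<noteq> 0"
    by (metis fps_zero_nth zero_neq_one)
  ultimately show ?thesis
    by simp
qed

fun golden_coeff :: "nat \<Rightarrow> int" where
  "golden_coeff 0 = 1"
| "golden_coeff (Suc n) = golden_coeff n + (if n = 0 then 0 else golden_coeff (n - 1))
     - (\<Sum>i\<in>{0..n}. golden_coeff i * golden_coeff (n - i))"

lemma is_golden_series_coeff: "is_golden_series (Abs_fps golden_coeff)"
proof -
  let ?G = "Abs_fps golden_coeff"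
  have "?G = 1 + fps_X * (?G + fps_X * ?G - ?G * ?G)"
  proof (rule fps_ext)
    fix n
    show "fps_nth ?G n = fps_nth (1 + fps_X * (?G + fps_X * ?G - ?G * ?G)) n"
      by (cases n) (simp_all add: fps_mult_nth[of ?G ?G])
  qed
  thus ?thesis
    unfolding is_golden_series_def by (simp add: algebra_simps power2_eq_square)
qed

lemma golden_series_eq_coeff: "golden_series = Abs_fps golden_coeff"
  unfolding golden_series_def
  using is_golden_series_coeff is_golden_series_unique by blast

lemma golden_series_eq: "fps_X * golden_series ^ 2 + (1 - fps_X - fps_X ^ 2) * golden_series = 1"
  using is_golden_series_coeff by (simp add: golden_series_eq_coeff is_golden_series_def)

(* The closed form 2 q G = q^2 + q - 1 + S, where S is the square root of
   (1 - q + q^2) (1 + 3 q + q^2) with constant term 1. *)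
lemma golden_series_closed_form:
  defines "S \<equiv> 2 * fps_X * golden_series - (fps_X ^ 2 + fps_X - 1)"
  shows "S ^ 2 = (1 - fps_X + fps_X ^ 2) * (1 + 3 * fps_X + fps_X ^ 2)" "fps_nth S 0 = 1"
proof -
  let ?X = "fps_X :: int fps"
  have "S ^ 2 = 4 * ?X * (?X * golden_series ^ 2 + (1 - ?X - ?X ^ 2) * golden_series)
      + (?X ^ 2 + ?X - 1) ^ 2"
    unfolding S_def by (simp add: algebra_simps power2_eq_square)
  also have "\<dots> = 4 * ?X + (?X ^ 2 + ?X - 1) ^ 2"
    by (simp add: golden_series_eq)
  also have "\<dots> = (1 - ?X + ?X ^ 2) * (1 + 3 * ?X + ?X ^ 2)"
    by (simp add: algebra_simps power2_eq_square)
  finally show "S ^ 2 = (1 - fps_X + fps_X ^ 2) * (1 + 3 * fps_X + fps_X ^ 2)" .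
  show "fps_nth S 0 = 1"
    by (simp add: S_def power2_eq_square mult.assoc)
qed

end

theory Submission
  imports Defs
begin

text \<open>
  If F * W = X^d with W(0) = 1 and T is the unitriangular Toeplitz matrix of W, the congruence
  by T makes the Hankel matrix of F block diagonal: a corner block that vanishes above the antidiagonal, and
  the Hankel matrix of - (W shifted by d + 2). Since the golden series is quadratic, iterating
  this step runs through finitely many series, and the first return happens at size n - 4, with
  a sign change. Writing g for the golden series shifted by 2, the steps are
  G \<rightarrow> 1 - X g \<rightarrow> - X g, then X g \<rightarrow> - g and g \<rightarrow> 1 - X g; the shift by 3 is a separate
  cycle of length 2.
\<close>

section \<open>Hankel determinants and reciprocals of power series\<close>

lemma fps_mult_nth_atMost:
  "fps_nth (f * g) n = (\<Sum>i\<le>n. fps_nth f i * fps_nth g (n - i))"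
  by (simp add: fps_mult_nth atLeast0AtMost)

text \<open>The entry (i, j) of T A T^t, where A is the infinite Hankel matrix of \<open>F\<close>
  and T the lower triangular Toeplitz matrix of \<open>W\<close>. Triangularity makes the sums
  finite and the entry independent of any truncation size.\<close>

definition hankel_congruence :: "'a :: comm_ring_1 fps \<Rightarrow> 'a fps \<Rightarrow> nat \<Rightarrow> nat \<Rightarrow> 'a" where
  "hankel_congruence F W i j =
     (\<Sum>a\<le>i. \<Sum>b\<le>j. fps_nth W (i - a) * fps_nth F (a + b) * fps_nth W (j - b))"

lemma hankel_congruence_commute: "hankel_congruence F W i j = hankel_congruence F W j i"
  unfolding hankel_congruence_def
  by (subst sum.swap) (simp add: mult_ac add.commute)

lemma hankel_congruence_Suc:
  "hankel_congruence F W (Suc i) j =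
     fps_nth W (Suc i) * fps_nth (F * W) j +
     (\<Sum>a\<le>i. \<Sum>b\<le>j. fps_nth W (i - a) * fps_nth F (Suc (a + b)) * fps_nth W (j - b))"
  unfolding hankel_congruence_def
  by (simp del: sum.atMost_Suc add: sum.atMost_Suc_shift fps_mult_nth_atMost sum_distrib_left mult_ac)

text \<open>Splitting off the zeroth row or column isolates a coefficient of \<open>F * W\<close>.
  What remains is the same double sum on both sides by symmetry, so neighbours on an antidiagonal
  differ only through \<open>F * W\<close>.\<close>

lemma hankel_congruence_Suc_diff:
  "hankel_congruence F W (Suc i) j + fps_nth W (Suc j) * fps_nth (F * W) i =
     hankel_congruence F W i (Suc j) + fps_nth W (Suc i) * fps_nth (F * W) j"
proof -
  have "(\<Sum>a\<le>j. \<Sum>b\<le>i. fps_nth W (j - a) * fps_nth F (Suc (a + b)) * fps_nth W (i - b)) =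
        (\<Sum>a\<le>i. \<Sum>b\<le>j. fps_nth W (i - a) * fps_nth F (Suc (a + b)) * fps_nth W (j - b))"
    by (subst sum.swap) (simp add: mult_ac add.commute)
  thus ?thesis
    by (subst (2) hankel_congruence_commute) (simp add: hankel_congruence_Suc)
qed

text \<open>Walk along the antidiagonal i + j = s starting at i = 0. As \<open>F * W\<close> has the
  single coefficient at d, the entry changes only twice: W(s - d) is added on entering column d and
  subtracted on leaving row d. For s \<le> 2d the addition comes no later than the subtraction,
  giving the corner block; for larger s the order is reversed, giving the negated block, or the two
  coincide and cancel.\<close>

lemma hankel_congruence_reciprocal:
  fixes F W :: "'a :: comm_ring_1 fps"
  assumes "F * W = fps_X ^ d"
  shows "hankel_congruence F W i j =
    (if i \<le> d \<and> j \<le> d then if i + j < d then 0 else fps_nth W (i + j - d)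
     else if i \<le> d \<or> j \<le> d then 0 else - fps_nth W (i + j - d))"
proof (induction i arbitrary: j)
  case 0
  have "hankel_congruence F W 0 j = fps_nth W 0 * fps_nth (F * W) j"
    by (simp add: hankel_congruence_def fps_mult_nth_atMost sum_distrib_left mult_ac)
  thus ?case
    by (auto simp: assms)
next
  case (Suc i)
  have "hankel_congruence F W (Suc i) j =
      hankel_congruence F W i (Suc j) + (if j = d then fps_nth W (Suc i) else 0)
        - (if i = d then fps_nth W (Suc j) else 0)"
    using hankel_congruence_Suc_diff[of F W i j] by (auto simp: assms algebra_simps)
  thus ?case
    unfolding Suc by (auto simp: not_le)
qed

text \<open>The first row has its only nonzero entry, 1, in the last column; deleting both leaves
  the same shape one size smaller. The exponent d(d + 1)/2 collects the cofactor signs.\<close>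

lemma det_antitriangular_corner:
  fixes w :: "nat \<Rightarrow> 'a :: comm_ring_1"
  assumes "w 0 = 1"
  shows "det (mat (Suc d) (Suc d) (\<lambda>(i, j). if i + j < d then 0 else w (i + j - d))) =
    (- 1) ^ (\<Sum>{..d})"
proof (induction d)
  case 0
  show ?case
    by (simp add: det_single assms)
next
  case (Suc d)
  let ?M = "\<lambda>d. mat (Suc d) (Suc d) (\<lambda>(i, j). if i + j < d then 0 else w (i + j - d))"
  have "det (?M (Suc d)) = (\<Sum>j<Suc (Suc d). ?M (Suc d) $$ (0, j) * cofactor (?M (Suc d)) 0 j)"
    by (rule laplace_expansion_row) auto
  also have "\<dots> = (\<Sum>j<Suc (Suc d). if j = Suc d then cofactor (?M (Suc d)) 0 (Suc d) else 0)"
    by (rule sum.cong) (auto simp: assms)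
  also have "\<dots> = cofactor (?M (Suc d)) 0 (Suc d)"
    by simp
  also have "mat_delete (?M (Suc d)) 0 (Suc d) = ?M d"
    by (rule eq_matI) (auto simp: mat_delete_def)
  hence "cofactor (?M (Suc d)) 0 (Suc d) = (- 1) ^ Suc d * (- 1) ^ (\<Sum>{..d})"
    by (simp add: cofactor_def Suc)
  finally show ?case
    by (simp add: power_add mult_ac)
qed

text \<open>The engine of all later reductions. The lower block starts at i = j = d + 1, where the
  index i + j - d equals d + 2; this explains the shift.\<close>

theorem hankel_det_reciprocal:
  fixes F W H :: "'a :: idom fps"
  assumes FW: "F * W = fps_X ^ d" and W0: "fps_nth W 0 = 1" and H: "fps_shift (d + 2) W = - H"
  shows "hankel_det 0 (n + Suc d) F = (- 1) ^ (\<Sum>{..d}) * hankel_det 0 n H"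
proof -
  let ?N = "Suc d + n"
  define T where "T = mat ?N ?N (\<lambda>(i, a). if a \<le> i then fps_nth W (i - a) else 0)"
  \<comment> \<open>The summand 0 matches the unfolded form of \<open>hankel_det\<close> at shift 0;
    likewise in \<open>B2\<close>.\<close>
  define A where "A = mat ?N ?N (\<lambda>(i, j). fps_nth F (0 + i + j))"
  define B1 where "B1 = mat (Suc d) (Suc d)
    (\<lambda>(i, j). if i + j < d then 0 else fps_nth W (i + j - d))"
  define B2 where "B2 = mat n n (\<lambda>(i, j). fps_nth H (0 + i + j))"
  have carrier: "T \<in> carrier_mat ?N ?N" "A \<in> carrier_mat ?N ?N"
      "B1 \<in> carrier_mat (Suc d) (Suc d)" "B2 \<in> carrier_mat n n"
    by (simp_all add: T_def A_def B1_def B2_def)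
  have dim_simps [simp]: "dim_row T = ?N" "dim_col T = ?N" "dim_row A = ?N" "dim_col A = ?N"
      "dim_row B1 = Suc d" "dim_col B1 = Suc d" "dim_row B2 = n" "dim_col B2 = n"
    by (simp_all add: T_def A_def B1_def B2_def)
  have detT: "det T = 1"
  proof -
    have "det T = prod_list (diag_mat T)"
      by (rule det_lower_triangular[where n = ?N]) (auto simp: T_def)
    also have "diag_mat T = map (\<lambda>_. 1) [0..<?N]"
      by (simp add: diag_mat_def T_def W0 del: upt_Suc)
    finally show ?thesis
      by (simp add: map_replicate_const)
  qed
  \<comment> \<open>Both sums run over the full size, but \<open>T\<close> vanishes above the
    diagonal, which cuts them down to a \<le> i and b \<le> j.\<close>
  have entry: "(T * (A * transpose_mat T)) $$ (i, j) = hankel_congruence F W i j"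
    if "i < ?N" "j < ?N" for i j
  proof -
    have "(T * (A * transpose_mat T)) $$ (i, j) =
        (\<Sum>a<?N. T $$ (i, a) * (\<Sum>b<?N. A $$ (a, b) * T $$ (j, b)))"
      using that by (simp add: scalar_prod_def lessThan_atLeast0 del: sum.op_ivl_Suc)
    also have "\<dots> = (\<Sum>a\<le>i. T $$ (i, a) * (\<Sum>b<?N. A $$ (a, b) * T $$ (j, b)))"
      using that by (intro sum.mono_neutral_right) (auto simp: T_def)
    also have "\<dots> = (\<Sum>a\<le>i. T $$ (i, a) * (\<Sum>b\<le>j. A $$ (a, b) * T $$ (j, b)))"
      using that
      by (intro sum.cong refl arg_cong2[where f = "(*)"] sum.mono_neutral_right)
        (auto simp: T_def)
    also have "\<dots> = hankel_congruence F W i j"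
      using that unfolding hankel_congruence_def sum_distrib_left
      by (intro sum.cong refl) (auto simp: T_def A_def mult_ac)
    finally show ?thesis .
  qed
  have "T * (A * transpose_mat T) = four_block_mat B1 (0\<^sub>m (Suc d) n) (0\<^sub>m n (Suc d)) B2"
  proof (rule eq_matI)
    fix i j
    assume "i < dim_row (four_block_mat B1 (0\<^sub>m (Suc d) n) (0\<^sub>m n (Suc d)) B2)"
      "j < dim_col (four_block_mat B1 (0\<^sub>m (Suc d) n) (0\<^sub>m n (Suc d)) B2)"
    hence ij: "i < ?N" "j < ?N"
      by simp_all
    have "- fps_nth W (i + j - d) = fps_nth H (i - Suc d + (j - Suc d))" if "d < i" "d < j"
    proof -
      have "i - Suc d + (j - Suc d) + (d + 2) = i + j - d"
        using that by simp
      thus ?thesis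
        using fps_shift_nth[of "d + 2" W "i - Suc d + (j - Suc d)"] unfolding H
        by (metis add.inverse_inverse fps_neg_nth)
    qed
    thus "(T * (A * transpose_mat T)) $$ (i, j) =
        four_block_mat B1 (0\<^sub>m (Suc d) n) (0\<^sub>m n (Suc d)) B2 $$ (i, j)"
      using ij unfolding entry[OF ij] hankel_congruence_reciprocal[OF FW]
      by (auto simp: B1_def B2_def less_Suc_eq_le)
  qed simp_all
  moreover have "det (T * (A * transpose_mat T)) = det T * (det A * det T)"
  proof -
    have T': "transpose_mat T \<in> carrier_mat ?N ?N"
      using carrier(1) by (simp only: transpose_carrier_mat)
    show ?thesis
      unfolding det_mult[OF carrier(1) mult_carrier_mat[OF carrier(2) T']]
        det_mult[OF carrier(2) T'] det_transpose[OF carrier(1)] ..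
  qed
  moreover have "det (four_block_mat B1 (0\<^sub>m (Suc d) n) (0\<^sub>m n (Suc d)) B2) = det B1 * det B2"
    by (rule det_four_block_mat_lower_left_zero[OF carrier(3) _ _ carrier(4)]) simp_all
  ultimately have "det A = det B1 * det B2"
    by (simp add: detT)
  also have "det B1 = (- 1) ^ (\<Sum>{..d})"
    unfolding B1_def by (rule det_antitriangular_corner) (rule W0)
  finally show ?thesis
    by (simp add: hankel_det_def A_def B2_def add.commute)
qed

section \<open>Shifts, signs and size one\<close>

lemma hankel_det_shift: "hankel_det l n f = hankel_det 0 n (fps_shift l f)"
  by (simp add: hankel_det_def add_ac)

lemma hankel_det_uminus: "hankel_det l n (- f) = (- 1) ^ n * hankel_det l n f"
proof -
  have "mat n n (\<lambda>(i, j). fps_nth (- f) (l + i + j)) =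
      (- 1) \<cdot>\<^sub>m mat n n (\<lambda>(i, j). fps_nth f (l + i + j))"
    by (rule eq_matI) auto
  thus ?thesis
    by (simp add: hankel_det_def det_smult)
qed

lemma hankel_det_1: "hankel_det l (Suc 0) f = fps_nth f l"
  by (simp add: hankel_det_def det_single)

section \<open>The golden series\<close>

abbreviation golden_tail :: "int fps" where
  "golden_tail \<equiv> fps_shift 2 golden_series"

lemma golden_series_nth:
  "fps_nth golden_series 0 = 1" "fps_nth golden_series 1 = 0"
  "fps_nth golden_series 2 = 1" "fps_nth golden_series 3 = - 1"
  by (simp_all add: golden_series_eq_coeff numeral_2_eq_2 numeral_3_eq_3)

lemma golden_series_eq_tail: "golden_series = 1 + fps_X ^ 2 * golden_tail"
proof (rule fps_ext)
  fix n :: nat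
  consider "n = 0" | "n = 1" | m where "n = m + 2"
    by (metis One_nat_def add_2_eq_Suc' not0_implies_Suc)
  thus "fps_nth golden_series n = fps_nth (1 + fps_X ^ 2 * golden_tail) n"
    by cases (use golden_series_nth in \<open>auto simp: fps_X_power_mult_nth\<close>)
qed

lemma golden_series_shift_1: "fps_shift 1 golden_series = fps_X * golden_tail"
proof (rule fps_ext)
  show "fps_nth (fps_shift 1 golden_series) n = fps_nth (fps_X * golden_tail) n" for n
    using golden_series_nth by (cases n) auto
qed

text \<open>Substituting G = 1 + X^2 g into the quadratic equation leaves a multiple of X^2, which
  is cancelled. This gives 1/g explicitly in terms of g.\<close>

lemma golden_tail_eq:
  "golden_tail * (1 + fps_X - fps_X ^ 2 + fps_X ^ 3 * golden_tail) = 1"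
proof -
  let ?X = "fps_X :: int fps" and ?g = golden_tail
  have "?X ^ 2 * (?g * (1 + ?X - ?X ^ 2 + ?X ^ 3 * ?g)) =
      ?X * (1 + ?X ^ 2 * ?g) ^ 2 + (1 - ?X - ?X ^ 2) * (1 + ?X ^ 2 * ?g) - 1 + ?X ^ 2 * 1"
    by Groebner_Basis.algebra
  also have "\<dots> = ?X ^ 2 * 1"
    using golden_series_eq by (simp flip: golden_series_eq_tail)
  finally show ?thesis
    by simp
qed

text \<open>Up to sign, the common remainder of 1/G and 1/g after their first two
  coefficients.\<close>

abbreviation golden_aux :: "int fps" where
  "golden_aux \<equiv> 1 - fps_X * golden_tail"

section \<open>Reduction steps for the shifts by 0, 1 and 2\<close>

lemma hankel_det_golden_0: "hankel_det 0 (Suc n) golden_series = hankel_det 0 n golden_aux"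
proof -
  \<comment> \<open>The quadratic equation gives 1/G = X G + 1 - X - X^2 = 1 - X^2 + X^3 g.\<close>
  let ?W = "1 - fps_X ^ 2 * golden_aux"
  have "golden_series * ?W = fps_X ^ 0"
    using golden_tail_eq by (subst golden_series_eq_tail) Groebner_Basis.algebra
  moreover have "fps_nth ?W 0 = 1"
    by (simp add: fps_X_power_mult_nth)
  moreover have "fps_shift (0 + 2) ?W = - golden_aux"
    by (rule fps_ext) (auto simp: fps_X_power_mult_nth)
  ultimately show ?thesis
    using hankel_det_reciprocal[of golden_series ?W 0 golden_aux n] by simp
qed

lemma hankel_det_golden_aux:
  "hankel_det 0 (Suc n) golden_aux = (- 1) ^ n * hankel_det 1 n golden_series"
proof -
  let ?W = "1 + fps_X + fps_X ^ 2 * (fps_X * golden_tail)"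
  have "golden_aux * ?W = fps_X ^ 0"
    using golden_tail_eq by Groebner_Basis.algebra
  moreover have "fps_nth ?W 0 = 1"
    by (simp add: fps_X_power_mult_nth)
  moreover have "fps_shift (0 + 2) ?W = - (- (fps_X * golden_tail))"
    by (rule fps_ext) (auto simp: fps_X_power_mult_nth)
  ultimately have "hankel_det 0 (n + Suc 0) golden_aux =
      (- 1) ^ (\<Sum>{..0}) * hankel_det 0 n (- (fps_X * golden_tail))"
    by (rule hankel_det_reciprocal)
  thus ?thesis
    unfolding hankel_det_shift[of 1] golden_series_shift_1 hankel_det_uminus by simp
qed

lemma hankel_det_golden_1:
  "hankel_det 1 (n + 2) golden_series = - ((- 1) ^ n * hankel_det 2 n golden_series)"
proof -
  \<comment> \<open>Here \<open>?W\<close> is 1/g. Since X g has no constant term, d = 1: the size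
    drops by 2 and the corner contributes -1.\<close>
  let ?W = "1 + fps_X - fps_X ^ 2 + fps_X ^ 3 * golden_tail"
  have "fps_X * golden_tail * ?W = fps_X ^ 1"
    using golden_tail_eq by Groebner_Basis.algebra
  moreover have "fps_nth ?W 0 = 1"
    by (simp add: fps_X_power_mult_nth)
  moreover have "fps_shift (1 + 2) ?W = - (- golden_tail)"
    by (rule fps_ext) (auto simp: fps_X_power_mult_nth)
  ultimately have "hankel_det 0 (n + Suc 1) (fps_X * golden_tail) =
      (- 1) ^ (\<Sum>{..1}) * hankel_det 0 n (- golden_tail)"
    by (rule hankel_det_reciprocal)
  thus ?thesis
    unfolding hankel_det_shift[of 1] hankel_det_shift[of 2] golden_series_shift_1
      hankel_det_uminus by simp
qed

text \<open>1/g and 1/G differ only by X, which the shift by 2 discards, so both reduce to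
  \<open>golden_aux\<close>. Size 0 is separate because the reduction consumes one row.\<close>

lemma hankel_det_golden_2: "hankel_det 2 n golden_series = hankel_det 0 n golden_series"
proof (cases n)
  case 0
  thus ?thesis
    by (simp add: hankel_det_0)
next
  case (Suc m)
  let ?W = "1 + fps_X - fps_X ^ 2 * golden_aux"
  have "golden_tail * ?W = fps_X ^ 0"
    using golden_tail_eq by Groebner_Basis.algebra
  moreover have "fps_nth ?W 0 = 1"
    by (simp add: fps_X_power_mult_nth)
  moreover have "fps_shift (0 + 2) ?W = - golden_aux"
    by (rule fps_ext) (auto simp: fps_X_power_mult_nth)
  ultimately have "hankel_det 0 (m + Suc 0) golden_tail =
      (- 1) ^ (\<Sum>{..0}) * hankel_det 0 m golden_aux"
    by (rule hankel_det_reciprocal)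
  thus ?thesis
    unfolding hankel_det_shift[of 2] Suc by (simp add: hankel_det_golden_0)
qed

section \<open>The shift by three\<close>

text \<open>The sign makes the constant coefficient 1, because that of the shifted series is
  -1.\<close>

abbreviation golden_tail3 :: "int fps" where
  "golden_tail3 \<equiv> - fps_shift 3 golden_series"

lemma golden_tail_eq_tail3: "golden_tail = 1 - fps_X * golden_tail3"
proof (rule fps_ext)
  show "fps_nth golden_tail n = fps_nth (1 - fps_X * golden_tail3) n" for n
    using golden_series_nth by (cases n) (auto simp: eval_nat_numeral)
qed

lemma golden_tail3_eq:
  "golden_tail3 * (1 + fps_X - fps_X ^ 2 + 2 * fps_X ^ 3 - fps_X ^ 4 * golden_tail3) =
     1 - fps_X + fps_X ^ 2"
proof -
  have "fps_X * (golden_tail3 *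
      (1 + fps_X - fps_X ^ 2 + 2 * fps_X ^ 3 - fps_X ^ 4 * golden_tail3)) =
      fps_X * (1 - fps_X + fps_X ^ 2)"
    using golden_tail_eq[unfolded golden_tail_eq_tail3] by Groebner_Basis.algebra
  thus ?thesis
    using fps_X_neq_zero mult_left_cancel by blast
qed

text \<open>Write h for \<open>golden_tail3\<close>. With P = 1 - X + X^2 and V = P/h, the series is
  K = h/P. The two steps have d = 0 and d = 2, so together they shrink the size by 4 and change the
  sign once.\<close>

lemma hankel_det_golden_tail3:
  obtains K :: "int fps" where
    "\<And>n. hankel_det 0 (Suc n) golden_tail3 = hankel_det 0 n (fps_X ^ 2 * K)"
    "\<And>n. hankel_det 0 (n + 3) (fps_X ^ 2 * K) = - hankel_det 0 n golden_tail3"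
proof -
  let ?P = "1 - fps_X + fps_X ^ 2 :: int fps"
  define E where "E = fps_right_inverse ?P 1"
  have E: "?P * E = 1"
    unfolding E_def by (rule fps_right_inverse) simp
  define K where "K = golden_tail3 * E"
  let ?V = "1 + fps_X - fps_X ^ 2 + 2 * fps_X ^ 3 - fps_X ^ 4 * golden_tail3"
  \<comment> \<open>This is 1/h = V/P, obtained from V = (1 + 2X) P - X^4 h.\<close>
  let ?W = "1 + 2 * fps_X - fps_X ^ 2 * (fps_X ^ 2 * K)"
  have "?W = ?V * E"
    unfolding K_def using E by Groebner_Basis.algebra
  hence "golden_tail3 * ?W = fps_X ^ 0"
    using golden_tail3_eq E by Groebner_Basis.algebra
  moreover have "fps_nth ?W 0 = 1"
    by (simp add: fps_X_power_mult_nth)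
  moreover have "fps_shift (0 + 2) ?W = - (fps_X ^ 2 * K)"
    by (rule fps_ext) (auto simp: fps_X_power_mult_nth numeral_fps_const)
  ultimately have 1: "hankel_det 0 (Suc n) golden_tail3 = hankel_det 0 n (fps_X ^ 2 * K)" for n
    using hankel_det_reciprocal[of golden_tail3 ?W 0 "fps_X ^ 2 * K" n] by simp
  \<comment> \<open>The factor P cancels, so \<open>?V\<close> itself serves as the multiplier for
    X^2 K with d = 2.\<close>
  have "fps_X ^ 2 * K * ?V = fps_X ^ 2"
    unfolding K_def using golden_tail3_eq E by Groebner_Basis.algebra
  moreover have "fps_nth ?V 0 = 1"
    by (simp add: fps_X_power_mult_nth)
  moreover have "fps_shift (2 + 2) ?V = - golden_tail3"
    by (rule fps_ext) (auto simp: fps_X_power_mult_nth numeral_fps_const)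
  moreover have "(\<Sum>{..2::nat}) = 3"
    by (simp add: eval_nat_numeral)
  ultimately have 2: "hankel_det 0 (n + 3) (fps_X ^ 2 * K) = - hankel_det 0 n golden_tail3" for n
    using hankel_det_reciprocal[of "fps_X ^ 2 * K" ?V 2 golden_tail3 n] by simp
  show ?thesis
    using that 1 2 by blast
qed

lemma hankel_det_golden_3: "hankel_det 3 n golden_series = (- 1) ^ n * hankel_det 0 n golden_tail3"
  by (simp add: hankel_det_uminus hankel_det_shift[of 3] flip: mult.assoc power_mult_distrib)

lemma hankel_det_golden_3_antiperiodic:
  "hankel_det 3 (n + 4) golden_series = - hankel_det 3 n golden_series"
proof -
  obtain K :: "int fps" where
    "\<And>n. hankel_det 0 (Suc n) golden_tail3 = hankel_det 0 n (fps_X ^ 2 * K)"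
    "\<And>n. hankel_det 0 (n + 3) (fps_X ^ 2 * K) = - hankel_det 0 n golden_tail3"
    using hankel_det_golden_tail3 by blast
  from this(1)[of "n + 3"] this(2)[of n] show ?thesis
    unfolding hankel_det_golden_3 by (simp add: eval_nat_numeral)
qed

lemma hankel_det_golden_3_zero:
  assumes "n \<in> {2, 3}"
  shows "hankel_det 3 n golden_series = 0"
proof -
  obtain K :: "int fps" where
    K: "\<And>n. hankel_det 0 (Suc n) golden_tail3 = hankel_det 0 n (fps_X ^ 2 * K)"
    using hankel_det_golden_tail3 by blast
  obtain m where m: "n = Suc m" "m \<in> {1, 2}"
    using assms by force
  \<comment> \<open>For m \<le> 2 the first row involves only the coefficients 0 and 1 of X^2 K,
    which vanish.\<close>
  have "hankel_det 0 m (fps_X ^ 2 * K) = 0"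
    unfolding hankel_det_def
    by (subst laplace_expansion_row[where n = m and i = 0])
       (use m in \<open>auto simp: fps_X_power_mult_nth\<close>)
  thus ?thesis
    using m by (simp add: hankel_det_golden_3 K)
qed

section \<open>Antiperiodicity\<close>

lemma hankel_det_golden_0_1:
  "hankel_det 0 (n + 2) golden_series = (- 1) ^ n * hankel_det 1 n golden_series"
  by (simp add: hankel_det_golden_0 hankel_det_golden_aux)

lemma hankel_det_golden_antiperiodic:
  assumes "l \<in> {0, 1, 2, 3}"
  shows "hankel_det l (n + 4) golden_series = - hankel_det l n golden_series"
proof -
  \<comment> \<open>The reductions 0 to 1 and 1 to 2 each drop the size by 2, and shift 2 agrees
    with shift 0. The powers of -1 cancel, leaving the corner sign -1 of the second
    reduction.\<close>
  have 0: "hankel_det 0 (n + 4) golden_series = - hankel_det 0 n golden_series" for n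
    using hankel_det_golden_0_1[of "n + 2"] hankel_det_golden_1[of n]
    unfolding hankel_det_golden_2
    by (simp add: eval_nat_numeral flip: mult.assoc power_mult_distrib)
  have 1: "hankel_det 1 (n + 4) golden_series = - hankel_det 1 n golden_series"
    using hankel_det_golden_1[of "n + 2"] hankel_det_golden_0_1[of n]
    unfolding hankel_det_golden_2
    by (simp add: eval_nat_numeral flip: mult.assoc power_mult_distrib)
  show ?thesis
    using assms 0 1 hankel_det_golden_3_antiperiodic by (auto simp: hankel_det_golden_2)
qed

section \<open>Initial values and range\<close>

lemma hankel_det_golden_initial:
  "map (\<lambda>n. hankel_det 0 n golden_series) [0..<4] = [1, 1, 1, 0]"
  "map (\<lambda>n. hankel_det 1 n golden_series) [0..<4] = [1, 0, - 1, 1]"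
  "map (\<lambda>n. hankel_det 2 n golden_series) [0..<4] = [1, 1, 1, 0]"
  "map (\<lambda>n. hankel_det 3 n golden_series) [0..<4] = [1, - 1, 0, 0]"
proof -
  show 0: "map (\<lambda>n. hankel_det 0 n golden_series) [0..<4] = [1, 1, 1, 0]"
    \<comment> \<open>Sizes 2 and 3 reduce to sizes 0 and 1, where the determinant is 1 or a single
      coefficient.\<close>
    using hankel_det_golden_0_1[of 0] hankel_det_golden_0_1[of 1] golden_series_nth
    by (simp add: upt_rec hankel_det_0 hankel_det_1 eval_nat_numeral)
  show "map (\<lambda>n. hankel_det 1 n golden_series) [0..<4] = [1, 0, - 1, 1]"
    using hankel_det_golden_1[of 0] hankel_det_golden_1[of 1] golden_series_nth
    by (simp add: upt_rec hankel_det_0 hankel_det_1 eval_nat_numeral)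
  show "map (\<lambda>n. hankel_det 2 n golden_series) [0..<4] = [1, 1, 1, 0]"
    unfolding hankel_det_golden_2 by (rule 0)
  show "map (\<lambda>n. hankel_det 3 n golden_series) [0..<4] = [1, - 1, 0, 0]"
    using hankel_det_golden_3_zero[of 2] hankel_det_golden_3_zero[of 3] golden_series_nth
    by (simp add: upt_rec hankel_det_0 hankel_det_1 eval_nat_numeral)
qed

lemma upt_8_eq: "[0..<8] = [0..<4] @ map (\<lambda>n. n + 4) [0..<4]"
  by (simp add: upt_rec)

lemma hankel_det_golden_first_eight:
  assumes "l \<in> {0, 1, 2, 3}"
  shows "map (\<lambda>n. hankel_det l n golden_series) [0..<8] =
    map (\<lambda>n. hankel_det l n golden_series) [0..<4] @
    map uminus (map (\<lambda>n. hankel_det l n golden_series) [0..<4])"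
  by (simp add: upt_8_eq hankel_det_golden_antiperiodic[OF assms] comp_def del: upt_rec_numeral)

lemma hankel_det_golden_range:
  assumes "l \<in> {0, 1, 2, 3}"
  shows "hankel_det l n golden_series \<in> {- 1, 0, 1}"
\<comment> \<open>Antiperiodicity steps back by 4, and the target set is closed under
  negation.\<close>
proof (induction n rule: less_induct)
  case (less n)
  show ?case
  proof (cases "n < 4")
    case True
    hence "hankel_det l n golden_series \<in> set (map (\<lambda>n. hankel_det l n golden_series) [0..<4])"
      by simp
    also have "\<dots> \<subseteq> {- 1, 0, 1}"
      using assms
      by (elim insertE emptyE)
        (simp_all add: hankel_det_golden_initial
          del: set_map list.set_map upt_rec_numeral One_nat_def)
    finally show ?thesis .
  next
    case False
    thus ?thesis
      using less[of "n - 4"] hankel_det_golden_antiperiodic[OF assms, of "n - 4"] by auto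
  qed
qed

theorem theorem1p6:
  fixes D :: "nat \<Rightarrow> nat \<Rightarrow> int"
  defines "D \<equiv> \<lambda>l n. hankel_det l n golden_series"
  shows "(\<forall>l\<in>{0, 1, 2, 3}.
            (\<forall>n. D l n \<in> {-1, 0, 1}) \<and>
            (\<forall>n. D l (n + 4) = - D l n) \<and>
            (\<forall>n. D l (n + 8) = D l n)) \<and>
         map (D 0) [0..<8] = [1, 1, 1, 0, -1, -1, -1, 0] \<and>
         map (D 1) [0..<8] = [1, 0, -1, 1, -1, 0, 1, -1] \<and>
         map (D 2) [0..<8] = [1, 1, 1, 0, -1, -1, -1, 0] \<and>
         map (D 3) [0..<8] = [1, -1, 0, 0, -1, 1, 0, 0] \<and>
         (\<forall>n. D 0 n = D 2 n) \<and>
         (\<forall>n\<ge>2. D 0 n = (-1) ^ n * D 1 (n - 2))"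
proof (intro conjI ballI allI impI)
  fix l n :: nat
  assume l: "l \<in> {0, 1, 2, 3}"
  show "D l n \<in> {-1, 0, 1}"
    unfolding D_def by (rule hankel_det_golden_range[OF l])
  show "D l (n + 4) = - D l n"
    unfolding D_def by (rule hankel_det_golden_antiperiodic[OF l])
  show "D l (n + 8) = D l n"
    using hankel_det_golden_antiperiodic[OF l, of n]
      hankel_det_golden_antiperiodic[OF l, of "n + 4"]
    by (simp add: D_def add.commute)
next
  show "map (D 0) [0..<8] = [1, 1, 1, 0, -1, -1, -1, 0]"
    and "map (D 1) [0..<8] = [1, 0, -1, 1, -1, 0, 1, -1]"
    and "map (D 2) [0..<8] = [1, 1, 1, 0, -1, -1, -1, 0]"
    and "map (D 3) [0..<8] = [1, -1, 0, 0, -1, 1, 0, 0]"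
    unfolding D_def
    by (simp_all add: hankel_det_golden_first_eight hankel_det_golden_initial
        del: upt_rec_numeral One_nat_def)
next
  show "D 0 n = D 2 n" for n
    by (simp add: D_def hankel_det_golden_2)
next
  fix n :: nat
  assume "n \<ge> 2"
  then obtain m where "n = m + 2"
    by (metis le_add_diff_inverse2)
  thus "D 0 n = (-1) ^ n * D 1 (n - 2)"
    using hankel_det_golden_0_1[of m] by (simp add: D_def)
qed

end
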